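(* For every positive integer $k$ there is an oriented regular hypermap $\mathcal{H}=(G,a,b)$ that is not self-dual and has duality coindex $k$.
   Context: An oriented regular hypermap is a triple $\mathcal{H}=(G,x,y)$ where $G$ is a group generated by the ordered pair $x,y$ (equivalently, $G=\Delta^+/H$ for a normal subgroup $H$ of the free group $\Delta^+$ of rank $2$, with $x,y$ the images of the two free generators). The group $G$ is the monodromy group $Mon(\mathcal{H})$. Two such triples $(G,x,y)$, $(G',x',y')$ are isomorphic if there is a group isomorphism $G\to G'$ with $x\mapsto x'$, $y\mapsto y'$. The (orientation-preserving) dual of $(G,x,y)$ is $(G,y,x)$, and $\mathcal{H}$ is self-dual if it is isomorphic to its dual, i.e. if there is an automorphism of $G$ interchanging $x$ and $y$. The duality group $D(\mathcal{H})$ is the smallest normal subgroup $N\trianglelefteq G$ such that the assignment $x\mapsto y$, $y\mapsto x$ induces an automorphism of $G/N$ (equivalently, such that $\mathcal{H}/N=(G/N,xN,yN)$ is self-dual). The duality index of $\mathcal{H}$ is $d=|D(\mathcal{H})|$. For finite $G$, the duality coindex of $\mathcal{H}$ is $|G|/d$. *)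

theory Defs
  imports "HOL-Algebra.Algebra"
begin

text \<open>A hypermap is the triple of a group and an ordered pair of its elements; the property of
  being an oriented regular hypermap is the predicate below.\<close>

type_synonym 'a hypermap = "'a monoid \<times> 'a \<times> 'a"

fun oriented_regular_hypermap :: "'a hypermap \<Rightarrow> bool" where
  "oriented_regular_hypermap (G, x, y) \<longleftrightarrow>
     group G \<and> x \<in> carrier G \<and> y \<in> carrier G \<and> generate G {x, y} = carrier G"

fun Mon :: "'a hypermap \<Rightarrow> 'a monoid" where
  "Mon (G, x, y) = G"

fun hypermap_isomorphic :: "'a hypermap \<Rightarrow> 'b hypermap \<Rightarrow> bool" where
  "hypermap_isomorphic (G, x, y) (G', x', y') \<longleftrightarrow> (\<exists>h \<in> iso G G'. h x = x' \<and> h y = y')"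

fun dual :: "'a hypermap \<Rightarrow> 'a hypermap" where
  "dual (G, x, y) = (G, y, x)"

definition self_dual :: "'a hypermap \<Rightarrow> bool" where
  "self_dual H \<longleftrightarrow> hypermap_isomorphic H (dual H)"

fun hypermap_quotient :: "'a hypermap \<Rightarrow> 'a set \<Rightarrow> 'a set hypermap" where
  "hypermap_quotient (G, x, y) N = (G Mod N, N #>\<^bsub>G\<^esub> x, N #>\<^bsub>G\<^esub> y)"

definition is_duality_group :: "'a hypermap \<Rightarrow> 'a set \<Rightarrow> bool" where
  "is_duality_group H N \<longleftrightarrow>
     N \<lhd> Mon H \<and> self_dual (hypermap_quotient H N) \<and>
     (\<forall>M. M \<lhd> Mon H \<and> self_dual (hypermap_quotient H M) \<longrightarrow> N \<subseteq> M)"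

text \<open>For an oriented regular hypermap a least such subgroup exists: the quotient by \<open>N\<close> is
  self-dual iff, for every word \<open>w\<close>, \<open>w(x,y) \<in> N\<close> holds exactly when \<open>w(y,x) \<in> N\<close>, and this
  condition is preserved under intersections.\<close>

definition duality_group :: "'a hypermap \<Rightarrow> 'a set" where
  "duality_group H = (THE N. is_duality_group H N)"

lemma duality_group_eqI:
  assumes "is_duality_group H N"
  shows "duality_group H = N"
  unfolding duality_group_def
proof (rule the_equality)
  show "is_duality_group H N" by (fact assms)
  show "M = N" if "is_duality_group H M" for M
    using assms that unfolding is_duality_group_def by blast
qed

definition duality_index :: "'a hypermap \<Rightarrow> nat" where
  "duality_index H = card (duality_group H)"

text \<open>Only meaningful for a finite monodromy group; the division is then exact by Lagrange.\<close>

definition duality_coindex :: "'a hypermap \<Rightarrow> nat" where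
  "duality_coindex H = order (Mon H) div duality_index H"

text \<open>Existence statements about hypermaps are made for groups with carrier in \<open>int\<close>: a group
  generated by two elements is countable, so every oriented regular hypermap is isomorphic to
  one of type \<open>int hypermap\<close>.\<close>

end

theory Submission
  imports Defs
begin

text \<open>A cyclic monodromy group suffices. In the hypermap \<open>(Z\<^sub>n, 1, u)\<close> the second generator is
  the \<open>u\<close>-th power of the first, so an automorphism interchanging them is the map
  \<open>z \<mapsto> u * z\<close>, and it squares to the identity on the generator: self-duality forces
  \<open>u\<^sup>2 \<equiv> 1\<close>, and the same holds in every quotient. Take \<open>u = k + 1\<close> and \<open>n = k * (k + 3)\<close>.
  This \<open>n\<close> is chosen so that \<open>u\<^sup>2 - 1 = k * (k + 2) = n - k\<close>, the inverse of \<open>k\<close> in \<open>Z\<^sub>n\<close>.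
  Hence every normal subgroup with a self-dual quotient contains \<open>k\<close> and all its multiples.
  Conversely, modulo \<open>k\<close> the two generators \<open>1\<close> and \<open>k + 1\<close> coincide, and equal elements are
  interchanged by the identity. So the duality group consists of the multiples of \<open>k\<close>, of which
  there are \<open>k + 3\<close>, and the coindex is \<open>n / (k + 3) = k\<close>. The hypermap itself is not self-dual,
  since \<open>u\<^sup>2 - 1 \<equiv> - k\<close> is nonzero modulo \<open>n\<close>.\<close>

text \<open>A swapping isomorphism must send \<open>y = x\<^sup>u\<close> both to \<open>x\<close> and to
  \<open>y\<^sup>u\<close>. Applied to a hypermap and to its quotients, this gives the lower bound for
  the duality group as well as the failure of self-duality.\<close>

lemma self_dual_power_imp_pow_square_eq:
  fixes u :: nat
  assumes "group G" "x \<in> carrier G" "self_dual (G, x, x [^]\<^bsub>G\<^esub> u)"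
  shows "x [^]\<^bsub>G\<^esub> (u * u) = x"
proof -
  interpret group G by fact
  obtain h where h: "h \<in> iso G G" "h x = x [^]\<^bsub>G\<^esub> u" "h (x [^]\<^bsub>G\<^esub> u) = x"
    using assms(3) by (auto simp: self_dual_def)
  interpret group_hom G G h
    using h(1) by unfold_locales (simp add: iso_def)
  have "x = h x [^]\<^bsub>G\<^esub> u"
    using h(3) hom_nat_pow assms(2) by simp
  then show ?thesis
    by (simp add: h(2) nat_pow_pow assms(2))
qed

lemma self_dual_equal_generators: "self_dual (G, x, x)"
  by (auto simp: self_dual_def intro!: bexI[of _ id] iso_set_refl[unfolded id_def[symmetric]])

lemma self_dual_quotient_imp_coset_pow_square_eq:
  fixes G :: "'a monoid" and u :: nat
  assumes "H \<lhd> G" and x: "x \<in> carrier G"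
    and sd: "self_dual (hypermap_quotient (G, x, x [^]\<^bsub>G\<^esub> u) H)"
  shows "H #>\<^bsub>G\<^esub> (x [^]\<^bsub>G\<^esub> (u * u)) = H #>\<^bsub>G\<^esub> x"
proof -
  interpret normal H G by fact
  interpret Q: group "G Mod H" by (rule factorgroup_is_group)
  interpret group_hom G "G Mod H" "\<lambda>a. H #>\<^bsub>G\<^esub> a"
    by unfold_locales (rule r_coset_hom_Mod)
  have "(H #>\<^bsub>G\<^esub> x) [^]\<^bsub>G Mod H\<^esub> (u * u) = H #>\<^bsub>G\<^esub> x"
    using Q.is_group hom_closed[OF x] sd
    by (intro self_dual_power_imp_pow_square_eq)
      (simp_all only: hypermap_quotient.simps hom_nat_pow[OF x])
  then show ?thesis by (simp only: hom_nat_pow[OF x])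
qed

lemma carrier_integer_mod_group_pos:
  "n > 0 \<Longrightarrow> carrier (integer_mod_group n) = {0..<int n}"
  by (simp add: carrier_integer_mod_group)

lemma oriented_regular_hypermap_integer_mod:
  assumes "n > 1" "y \<in> carrier (integer_mod_group n)"
  shows "oriented_regular_hypermap (integer_mod_group n, 1, y)"
proof -
  let ?Z = "integer_mod_group n"
  interpret group ?Z by (rule group_integer_mod_group)
  have one: "1 \<in> carrier ?Z"
    using assms by (simp add: carrier_integer_mod_group_pos)
  have "z \<in> generate ?Z {1, y}" if z: "z \<in> carrier ?Z" for z
  proof -
    have "subgroup (generate ?Z {1, y}) ?Z"
      using one assms(2) by (intro generate_is_subgroup) auto
    then have "1 [^]\<^bsub>?Z\<^esub> int (nat z) \<in> generate ?Z {1, y}"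
      by (rule subgroup_int_pow_closed) (simp add: generate.incl)
    then show ?thesis
      using z assms(1) by (simp add: int_pow_integer_mod_group carrier_integer_mod_group_pos)
  qed
  then show ?thesis
    using one assms(2) generate_in_carrier[of "{1, y}"] by auto
qed

lemma card_nonneg_multiples_below:
  assumes "k > 0"
  shows "card {z \<in> {0..<int (k * m)}. int k dvd z} = m"
proof -
  have "{z \<in> {0..<int (k * m)}. int k dvd z} = (\<lambda>i. int k * int i) ` {..<m}"
  proof (intro equalityI subsetI)
    fix z assume "z \<in> {z \<in> {0..<int (k * m)}. int k dvd z}"
    then obtain c where c: "z = int k * c" "0 \<le> int k * c" "int k * c < int k * int m"
      by auto
    then have "0 \<le> c" "c < int m"
      using assms by (simp_all add: zero_le_mult_iff)
    then show "z \<in> (\<lambda>i. int k * int i) ` {..<m}"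
      using c(1) by (intro image_eqI[of _ _ "nat c"]) auto
  next
    fix z assume "z \<in> (\<lambda>i. int k * int i) ` {..<m}"
    then show "z \<in> {z \<in> {0..<int (k * m)}. int k dvd z}"
      using assms by auto
  qed
  moreover have "inj_on (\<lambda>i. int k * int i) {..<m}"
    using assms by (auto intro: inj_onI)
  ultimately show ?thesis by (simp add: card_image)
qed

lemma succ_square_mod_eq:
  assumes "n = k * (k + 3)"
  shows "int ((k + 1) * (k + 1)) mod int n = (1 - int k) mod int n"
proof -
  have "int ((k + 1) * (k + 1)) = (1 - int k) + int n"
    by (simp add: assms algebra_simps)
  then show ?thesis
    by (simp only: mod_add_self2)
qed

text \<open>The generators agree modulo \<open>k\<close>, so factoring out the multiples of \<open>k\<close> gives a
  self-dual quotient. Every self-dual quotient identifies \<open>(k + 1)\<^sup>2\<close>, which is \<open>1 - k\<close>, with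
  \<open>1\<close> and therefore kills \<open>k\<close>.\<close>

lemma is_duality_group_multiples:
  assumes k: "k > 0" and n: "n = k * (k + 3)"
  shows "is_duality_group (integer_mod_group n, 1, int (k + 1))
           {z \<in> carrier (integer_mod_group n). int k dvd z}"
    (is "is_duality_group (?Z, _, ?u) ?N")
proof -
  interpret Z: comm_group ?Z by (rule abelian_integer_mod_group)
  have bound: "k + 2 < n"
    using k unfolding n by (cases k) auto
  have n1: "n > 1" using bound by simp
  note carr = carrier_integer_mod_group_pos[of n]
  have one: "1 \<in> carrier ?Z" and kc: "int k \<in> carrier ?Z"
    using bound by (simp_all add: carr)
  have u: "?u = 1 [^]\<^bsub>?Z\<^esub> (k + 1)"
    using n1 bound by simp
  have kn: "int k dvd int n" unfolding n by simp
  have sub: "subgroup ?N ?Z"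
  proof (rule Z.subgroupI)
    show "?N \<noteq> {}" using kc by auto
    show "inv\<^bsub>?Z\<^esub> a \<in> ?N" if "a \<in> ?N" for a
      using that n1 kn by (auto simp: carr dvd_mod_iff)
    show "a \<otimes>\<^bsub>?Z\<^esub> b \<in> ?N" if "a \<in> ?N" "b \<in> ?N" for a b
      using that n1 kn by (auto simp: carr dvd_mod_iff)
  qed auto
  then have normal: "?N \<lhd> ?Z" by (rule Z.subgroup_imp_normal)
  have u': "?u = int k \<otimes>\<^bsub>?Z\<^esub> 1"
    using bound by simp
  have "?N #>\<^bsub>?Z\<^esub> int k = ?N"
    by (rule Z.coset_join2[OF kc sub]) (use kc in simp)
  then have "?N #>\<^bsub>?Z\<^esub> ?u = ?N #>\<^bsub>?Z\<^esub> 1"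
    by (simp only: u' flip: Z.coset_mult_assoc[OF subgroup.subset[OF sub] kc one])
  then have "self_dual (hypermap_quotient (?Z, 1, ?u) ?N)"
    by (simp only: hypermap_quotient.simps self_dual_equal_generators)
  moreover have "?N \<subseteq> M"
    if M: "M \<lhd> ?Z" and sd: "self_dual (hypermap_quotient (?Z, 1, ?u) M)" for M
  proof
    interpret M: normal M ?Z by (fact M)
    have "M #>\<^bsub>?Z\<^esub> (1 [^]\<^bsub>?Z\<^esub> ((k + 1) * (k + 1))) = M #>\<^bsub>?Z\<^esub> 1"
      using sd unfolding u by (rule self_dual_quotient_imp_coset_pow_square_eq[OF M one])
    moreover have "1 [^]\<^bsub>?Z\<^esub> ((k + 1) * (k + 1)) = (1 - int k) mod int n"
      using succ_square_mod_eq[OF n] by (simp only: pow_integer_mod_group mult_1_right)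
    ultimately have "M #>\<^bsub>?Z\<^esub> ((1 - int k) mod int n) = M #>\<^bsub>?Z\<^esub> 1"
      by (simp only:)
    moreover have "(1 - int k) mod int n \<in> carrier ?Z"
      using n1 by (simp add: carr)
    ultimately have "1 \<otimes>\<^bsub>?Z\<^esub> inv\<^bsub>?Z\<^esub> ((1 - int k) mod int n) \<in> M"
      using M.rcos_module_imp[OF Z.is_group] Z.rcos_self[OF one M.subgroup_axioms] by metis
    moreover have "1 \<otimes>\<^bsub>?Z\<^esub> inv\<^bsub>?Z\<^esub> ((1 - int k) mod int n) = int k"
      using bound n1 by (simp add: carr mod_simps)
    ultimately have kM: "int k \<in> M"
      by simp
    fix z assume z: "z \<in> ?N"
    then have "z = int k [^]\<^bsub>?Z\<^esub> (z div int k)"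
      using k n1 by (simp add: int_pow_integer_mod_group carr)
    then show "z \<in> M"
      using Z.subgroup_int_pow_closed[OF M.subgroup_axioms kM] by metis
  qed
  ultimately show ?thesis
    using normal by (simp add: is_duality_group_def)
qed

theorem theorem4p2:
  fixes k :: nat
  assumes "k > 0"
  shows "\<exists>H :: int hypermap. oriented_regular_hypermap H \<and> finite (carrier (Mon H)) \<and>
           \<not> self_dual H \<and> duality_coindex H = k"
proof (intro exI conjI)
  define n where "n = k * (k + 3)"
  let ?H = "(integer_mod_group n, 1, int (k + 1))"
  have bound: "k + 2 < n"
    using assms unfolding n_def by (cases k) auto
  then have one: "1 \<in> carrier (integer_mod_group n)"
    and uc: "int (k + 1) \<in> carrier (integer_mod_group n)"
    by (simp_all add: carrier_integer_mod_group_pos)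
  show "oriented_regular_hypermap ?H"
    using bound uc by (intro oriented_regular_hypermap_integer_mod) auto
  show "finite (carrier (Mon ?H))"
    using bound by (simp add: carrier_integer_mod_group_pos)
  show "\<not> self_dual ?H"
  proof
    assume "self_dual ?H"
    moreover have "int (k + 1) = 1 [^]\<^bsub>integer_mod_group n\<^esub> (k + 1)"
      using bound by simp
    ultimately have "1 [^]\<^bsub>integer_mod_group n\<^esub> ((k + 1) * (k + 1)) = 1"
      using one by (intro self_dual_power_imp_pow_square_eq) simp_all
    then have "(1 - int k) mod int n = 1 mod int n"
      using succ_square_mod_eq[OF n_def] bound by (simp only: pow_integer_mod_group mult_1_right) simp
    then have "int n dvd int k"
      by (simp add: mod_eq_dvd_iff)
    then show False
      using bound assms by (auto dest: dvd_imp_le)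
  qed
  show "duality_coindex ?H = k"
  proof -
    have "duality_index ?H = card {z \<in> {0..<int (k * (k + 3))}. int k dvd z}"
      using bound duality_group_eqI[OF is_duality_group_multiples[OF assms n_def]]
      by (simp only: duality_index_def carrier_integer_mod_group_pos flip: n_def)
    also have "\<dots> = k + 3"
      by (rule card_nonneg_multiples_below[OF assms])
    finally have "duality_index ?H = k + 3" .
    moreover have "order (Mon ?H) = k * (k + 3)"
      using bound by (simp add: order_def carrier_integer_mod_group_pos) (simp add: n_def)
    ultimately show ?thesis
      by (simp only: duality_coindex_def) simp
  qed
qed

end
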